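(* Let $(L,\leq,0_L,1_L)$ be a bounded lattice, let $e_1,a,e_2\in L$ with $0_L\leq e_1\leq a\leq e_2\leq 1_L$, and let $f:L\to[-\infty,+\infty]$ be an injective decreasing function with $f(e_1)=0$. Suppose that $f$ satisfies the following five conditions for all $x,y\in L$: (i) if $(f(x),f(y))\in[f(a),0]^2\cup[0,+\infty]^2$, then $\max\{f(x)+f(y),f(a)\}\in\mathrm{Ran}(f)\cup(f(0_L),+\infty]$; (ii) if $(f(x),f(y))\in[f(a),0]^2\cup[0,+\infty]^2$ and $f(x)$ and $f(y)$ have at least one same summand $f(z)\in\mathrm{Ran}(f)$, then $x$ and $y$ are comparable; (iii) if $f(a)\leq f(x)<0<f(y)$ and $y<e_1$, then $x$ and $y$ are comparable; (iv) if $f(a)\geq f(x)>f(y)$ or $f(x)\leq f(a)<0<f(y)$, then $x$ and $y$ are comparable; (v) if $f(x),f(y)\in(f(a),0)$, $f(x)+f(y)\in\mathrm{Ran}(f)$ and $f(a)\leq f(x)+f(y)<0$, then $f^{-1}(f(x)+f(y))$ and $a$ are comparable. Then the following function $\mathbb{U}_d:L^2\to L$ is a 2-uninorm on $L$ (with respect to $e_1,a,e_2$), and $f$ is called an additive generator of $\mathbb{U}_d$: for all $x,y\in L$, $$\mathbb{U}_d(x,y)=\begin{cases} f^{(-1)}(f(x)+f(y)), & (f(x),f(y))\in[0,+\infty]^2,\\ f^{(-1)}(\max\{f(x)+f(y),f(a)\}), & (f(x),f(y))\in[f(a),0]^2 \text{ and } x,y\notin I_a,\\ a, & (f(x),f(y))\in[-\infty,f(a))\times[f(a),0]\cup[f(a),0]\times[-\infty,f(a))\\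 & \quad\cup[f(a),0]\times\mathcal{G}_a\cup\mathcal{G}_a\times[f(a),0],\\ f^{(-1)}(\min\{f(x),f(y)\}), & (f(x),f(y))\in[-\infty,f(e_2))^2\cup[-\infty,f(e_2))\times[f(e_2),f(a))\\ & \quad\cup[f(e_2),f(a))\times[-\infty,f(e_2)),\\ f^{(-1)}(\max\{f(x),f(y)\}), & \text{otherwise.} \end{cases}$$
   Context: A bounded lattice $(L,\leq,0_L,1_L)$ is a lattice with bottom element $0_L$ and top element $1_L$. Elements $x,y\in L$ are comparable if $x\leq y$ or $y\leq x$, and incomparable (written $x\parallel y$) otherwise. For $a\in L$, $I_a=\{x\in L: x\parallel a\}$. $\mathrm{Ran}(f)$ is the range of $f$. A function $f$ is decreasing if $x\leq y$ implies $f(x)\geq f(y)$. $\mathcal{G}_a=\{f(x): x\in I_a,\ f(a)<f(x)<0\}$. Pseudo-inverse: for an injective decreasing non-constant $f:L\to[-\infty,+\infty]$, $f^{(-1)}:[-\infty,+\infty]\to L$ is given, when it exists, by $f^{(-1)}(y)=f^{-1}(y)$ (the unique preimage) if $y\in\mathrm{Ran}(f)$, and $f^{(-1)}(y)=\sup\{x\in L: f(x)>y\}$ if $y\notin\mathrm{Ran}(f)$. Summand: let $0\in A\subseteq[-\infty,+\infty]$. For non-zero elements $x,s\in A$, $s$ is a summand of $x$ in $A$ if there is $b\in A$ with $x=s+b$ and $sb\geq 0$. The element $0$ has no summands; every non-zero $x\in A$ is a summand of itself. Here summands are taken in $A=\mathrm{Ran}(f)$ (which contains $0=f(e_1)$).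 2-uninorm: given $e_1,a,e_2\in L$ with $0_L\leq e_1\leq a\leq e_2\leq 1_L$, a binary operation $\mathbb{U}:L^2\to L$ is a 2-uninorm if it is commutative, associative, increasing in both variables, $\mathbb{U}(e_1,x)=x$ for all $x\leq a$, and $\mathbb{U}(e_2,x)=x$ for all $x\geq a$.
   Formalization: The claim as printed fails in boundary cases, so two conditions, necessary there and vacuous if e_1<a<e_2, are added: if a=e_2 then a=1_L; if e_1=a then all x,y with f(x)≤f(a) and f(y)>0 are comparable. *)

theory Defs
  imports "HOL-Library.Extended_Real" "HOL-Library.Lub_Glb"
begin

definition comparable :: "'a::order \<Rightarrow> 'a \<Rightarrow> bool" where
  "comparable x y \<longleftrightarrow> x \<le> y \<or> y \<le> x"

definition incomparables :: "'a::order \<Rightarrow> 'a set" where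
  "incomparables a = {x. \<not> comparable x a}"

definition G_set :: "('a::order \<Rightarrow> ereal) \<Rightarrow> 'a \<Rightarrow> ereal set" where
  "G_set f a = {f x | x. x \<in> incomparables a \<and> f a < f x \<and> f x < 0}"

text \<open>
  The pseudo-inverse is partial: the lattice need not be complete, so the supremum taken off the
  range of \<open>f\<close> may fail to exist; \<open>None\<close> means that the value is undefined.
\<close>

definition pseudo_inverse :: "('a::bounded_lattice \<Rightarrow> ereal) \<Rightarrow> ereal \<Rightarrow> 'a option" where
  "pseudo_inverse f y =
     (if y \<in> range f then Some (inv f y)
      else if \<exists>s. isLub UNIV {x. f x > y} s then Some (THE s. isLub UNIV {x. f x > y} s)
      else None)"

text \<open>
  The sign condition \<open>s * b \<ge> 0\<close> excludes the sums \<open>\<infinity> + (-\<infinity>)\<close>, whose library value is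
  only a convention. The library convention \<open>\<bar>\<infinity>\<bar> * 0 = 0\<close> lets \<open>b = 0\<close> witness
  that an infinite \<open>x\<close> is a summand of itself.
\<close>

definition summand_in :: "ereal set \<Rightarrow> ereal \<Rightarrow> ereal \<Rightarrow> bool" where
  "summand_in A s x \<longleftrightarrow>
     s \<in> A \<and> x \<in> A \<and> s \<noteq> 0 \<and> x \<noteq> 0 \<and> (\<exists>b\<in>A. x = s + b \<and> s * b \<ge> 0)"

definition two_uninorm ::
    "'a::bounded_lattice \<Rightarrow> 'a \<Rightarrow> 'a \<Rightarrow> ('a \<Rightarrow> 'a \<Rightarrow> 'a) \<Rightarrow> bool" where
  "two_uninorm e1 a e2 U \<longleftrightarrow>
     e1 \<le> a \<and> a \<le> e2 \<and>
     (\<forall>x y. U x y = U y x) \<and>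
     (\<forall>x y z. U (U x y) z = U x (U y z)) \<and>
     (\<forall>x x' y y'. x \<le> x' \<longrightarrow> y \<le> y' \<longrightarrow> U x y \<le> U x' y') \<and>
     (\<forall>x. x \<le> a \<longrightarrow> U e1 x = x) \<and>
     (\<forall>x. a \<le> x \<longrightarrow> U e2 x = x)"

definition U_d ::
    "('a::bounded_lattice \<Rightarrow> ereal) \<Rightarrow> 'a \<Rightarrow> 'a \<Rightarrow> 'a \<Rightarrow> 'a \<Rightarrow> 'a option" where
  "U_d f a e2 x y =
     (if (f x, f y) \<in> {0..\<infinity>} \<times> {0..\<infinity>} then
        pseudo_inverse f (f x + f y)
      else if (f x, f y) \<in> {f a..0} \<times> {f a..0} \<and> x \<notin> incomparables a \<and> y \<notin> incomparables a then
        pseudo_inverse f (max (f x + f y) (f a))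
      else if (f x, f y) \<in> {-\<infinity>..<f a} \<times> {f a..0} \<union> {f a..0} \<times> {-\<infinity>..<f a}
                         \<union> {f a..0} \<times> G_set f a \<union> G_set f a \<times> {f a..0} then
        Some a
      else if (f x, f y) \<in> {-\<infinity>..<f e2} \<times> {-\<infinity>..<f e2} \<union> {-\<infinity>..<f e2} \<times> {f e2..<f a}
                         \<union> {f e2..<f a} \<times> {-\<infinity>..<f e2} then
        pseudo_inverse f (min (f x) (f y))
      else
        pseudo_inverse f (max (f x) (f y)))"

end

theory Submission
  imports Defs
begin

text \<open>
  The conditions force the following picture: every \<open>x\<close> with \<open>f x > 0\<close> lies below \<open>a\<close>,
  the elements above \<open>a\<close> form a chain, and the elements incomparable with \<open>a\<close> have values
  strictly between \<open>f a\<close> and \<open>0\<close>. On \<open>{x. f x > 0}\<close> the operation is addition of values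
  truncated at \<open>f bot\<close>, and this set is an ideal on which all other elements act as identities.
  On the rest, \<open>a\<close> is a zero, and all products vanish (that is, equal \<open>a\<close>) except those inside
  \<open>{x. x \<le> a}\<close> (addition of values truncated at \<open>f a\<close>) and inside \<open>{x. a < x}\<close>
  (join or meet in a chain); this gives associativity. For monotonicity, two translates by the
  same \<open>z\<close> share the summand \<open>f z\<close>, hence are comparable, and their order is then read off
  from their values.
\<close>

section \<open>Truncated sums and the pseudo-inverse beyond the range\<close>

text \<open>If \<open>s\<close> exceeds \<open>M\<close>, both sides collapse to \<open>M\<close>.
  This removes the inner truncation of an iterated sum without cancellation, which fails for
  infinite values.\<close>

lemma min_add_min_absorb:
  fixes s r M :: "'a::{ordered_ab_semigroup_add, linorder}"
  assumes "M \<le> M + r"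
  shows "min (min s M + r) M = min (s + r) M"
proof (cases "s \<le> M")
  case False
  then have "M \<le> s + r"
    using assms add_right_mono[of M s r] order_trans[of M "M + r"] by auto
  with False assms show ?thesis
    by (simp add: min_def)
qed (simp add: min_def)

lemma max_add_max_absorb:
  fixes s r K :: "'a::{ordered_ab_semigroup_add, linorder}"
  assumes "K + r \<le> K"
  shows "max (max s K + r) K = max (s + r) K"
proof (cases "K \<le> s")
  case False
  then have "s + r \<le> K"
    using assms add_right_mono[of s K r] order_trans[of "s + r" "K + r"] by auto
  with False assms show ?thesis
    by (simp add: max_def)
qed (simp add: max_def)

lemma pseudo_inverse_range:
  "y \<in> range f \<Longrightarrow> pseudo_inverse f y = Some (inv f y)"
  by (simp add: pseudo_inverse_def)

text \<open>No value of \<open>f\<close> exceeds \<open>f bot\<close>, so the supremum is that of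
  the empty set.\<close>

lemma pseudo_inverse_above:
  fixes f :: "'a::bounded_lattice \<Rightarrow> ereal"
  assumes "antimono f" and "f bot < y"
  shows "pseudo_inverse f y = Some bot"
proof -
  have less: "f x < y" for x
    using antimonoD[OF assms(1), of bot x] assms(2) by auto
  have lub: "isLub UNIV {x. y < f x} s \<longleftrightarrow> s = bot" for s
  proof -
    have "{x. y < f x} = {}"
      using less by (auto dest: less_asym)
    then show ?thesis
      by (auto simp: isLub_def leastP_def isUb_def setge_def setle_def intro: bot.extremum_uniqueI)
  qed
  show ?thesis
    using less by (force simp: pseudo_inverse_def lub)
qed

section \<open>Position of elements relative to \<open>a\<close>, read off from their values\<close>

locale generator_2_uninorm =
  fixes f :: "'a::bounded_lattice \<Rightarrow> ereal" and e1 a e2 :: 'a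
  assumes e1_le_a: "e1 \<le> a" and a_le_e2: "a \<le> e2"
    and inj_f: "inj f"
    and decreasing_f: "antimono f"
    and f_e1: "f e1 = 0"
    and cond_i: "\<And>x y. (f x, f y) \<in> {f a..0} \<times> {f a..0} \<union> {0..\<infinity>} \<times> {0..\<infinity>} \<Longrightarrow>
          max (f x + f y) (f a) \<in> range f \<union> {f bot<..\<infinity>}"
    and cond_ii: "\<And>x y. (f x, f y) \<in> {f a..0} \<times> {f a..0} \<union> {0..\<infinity>} \<times> {0..\<infinity>} \<Longrightarrow>
          (\<exists>z. summand_in (range f) (f z) (f x) \<and> summand_in (range f) (f z) (f y)) \<Longrightarrow>
          comparable x y"
    and cond_iii: "\<And>x y. f a \<le> f x \<Longrightarrow> f x < 0 \<Longrightarrow> 0 < f y \<Longrightarrow> y < e1 \<Longrightarrow> comparable x y"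
    and cond_iv: "\<And>x y. (f a \<ge> f x \<and> f x > f y) \<or> (f x \<le> f a \<and> f a < 0 \<and> 0 < f y) \<Longrightarrow>
          comparable x y"
    and cond_v: "\<And>x y. f x \<in> {f a<..<0} \<Longrightarrow> f y \<in> {f a<..<0} \<Longrightarrow>
          f x + f y \<in> range f \<Longrightarrow> f a \<le> f x + f y \<Longrightarrow> f x + f y < 0 \<Longrightarrow>
          comparable (inv f (f x + f y)) a"
    and boundary_e1: "\<And>x y. e1 = a \<Longrightarrow> f x \<le> f a \<Longrightarrow> 0 < f y \<Longrightarrow> comparable x y"
    and boundary_e2: "a = e2 \<Longrightarrow> a = top"
begin

text \<open>Turns the comparability provided by the conditions into inequalities: by injectivity,
  distinct comparable elements have distinct values in reverse order.\<close>

lemma le_iff: "comparable x y \<Longrightarrow> x \<le> y \<longleftrightarrow> f y \<le> f x"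
  using antimonoD[OF decreasing_f, of x y] antimonoD[OF decreasing_f, of y x]
    injD[OF inj_f, of x y] order_antisym[of "f x" "f y"]
  by (auto simp: comparable_def)

lemma f_a_nonpos: "f a \<le> 0"
  using antimonoD[OF decreasing_f e1_le_a] f_e1 by simp

lemma f_le_bot: "f x \<le> f bot"
  by (rule antimonoD[OF decreasing_f]) simp

lemma f_bot_nonneg: "0 \<le> f bot"
  using f_le_bot[of e1] f_e1 by simp

lemma f_eq_iff [simp]: "f x = f y \<longleftrightarrow> x = y"
  using inj_f by (auto dest: injD)

lemma f_strict: "x < y \<Longrightarrow> f y < f x"
  using antimonoD[OF decreasing_f, of x y] by (auto simp: less_le)

lemma pos_le_a:
  assumes "0 < f x"
  shows "x \<le> a"
proof -
  have "comparable a x"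
  proof (cases "e1 = a")
    \<comment> \<open>Here \<open>f a = 0\<close>, and (iv) does not compare \<open>a\<close> with
      elements of positive value; \<open>boundary_e1\<close> does.\<close>
    case True
    with boundary_e1[of a x] assms show ?thesis by simp
  next
    case False
    then have "f a < 0"
      using f_strict[of e1 a] e1_le_a f_e1 by auto
    with cond_iv[of a x] assms show ?thesis by auto
  qed
  then have "comparable x a" by (auto simp: comparable_def)
  with le_iff assms f_a_nonpos show ?thesis by auto
qed

lemma f_less_a_iff: "f x < f a \<longleftrightarrow> a < x"
proof
  assume *: "f x < f a"
  then have "comparable a x" using cond_iv[of a x] by auto
  with le_iff * show "a < x" by (auto simp: less_le)
qed (rule f_strict)

lemma f_le_a_iff: "f x \<le> f a \<longleftrightarrow> a \<le> x"
  using f_less_a_iff[of x] by (auto simp: le_less)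

lemma above_a_comparable:
  assumes "a \<le> x" "a \<le> y"
  shows "comparable x y"
proof (cases "f x" "f y" rule: linorder_cases)
  case less
  with cond_iv[of y x] assms f_le_a_iff show ?thesis by (auto simp: comparable_def)
next
  case greater
  with cond_iv[of x y] assms f_le_a_iff show ?thesis by auto
qed (simp add: comparable_def)

lemma f_less_e2_iff: "a \<le> x \<Longrightarrow> f x < f e2 \<longleftrightarrow> e2 < x"
  using le_iff[OF above_a_comparable[OF _ a_le_e2, of x]] le_iff[OF above_a_comparable[OF a_le_e2, of x]]
  by (auto simp: less_le_not_le)

lemma incomparables_a: "x \<in> incomparables a \<longleftrightarrow> \<not> x \<le> a \<and> \<not> a < x"
  by (auto simp: incomparables_def comparable_def le_less)

text \<open>Values at most \<open>f a\<close> occur only above \<open>a\<close>, positive values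
  only below \<open>a\<close>, and the value 0 only at \<open>e1\<close>, which is below
  \<open>a\<close>.\<close>

lemma f_incomparable: "\<not> x \<le> a \<Longrightarrow> \<not> a < x \<Longrightarrow> f a < f x \<and> f x < 0"
  using pos_le_a[of x] f_le_a_iff[of x] f_e1 e1_le_a f_eq_iff[of x e1]
  by (metis le_less not_less)

lemma G_set_iff: "f x \<in> G_set f a \<longleftrightarrow> \<not> x \<le> a \<and> \<not> a < x"
  using f_incomparable[of x] by (auto simp: G_set_def incomparables_a)

section \<open>The operation as a total function\<close>

text \<open>Truncation at \<open>f bot\<close> encodes the value \<open>bot\<close> that the
  pseudo-inverse takes beyond \<open>f bot\<close>.\<close>

definition add_below :: "'a \<Rightarrow> 'a \<Rightarrow> 'a" where
  "add_below x y = inv f (min (f x + f y) (f bot))"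

definition add_mid :: "'a \<Rightarrow> 'a \<Rightarrow> 'a" where
  "add_mid x y = inv f (max (f x + f y) (f a))"

text \<open>Join and meet stand for the minimum and maximum of values in \<open>U_d\<close>: above
  \<open>a\<close> the elements form a chain on which \<open>f\<close> reverses the order.\<close>

definition op_above :: "'a \<Rightarrow> 'a \<Rightarrow> 'a" where
  "op_above x y = (if e2 < x \<or> e2 < y then sup x y else inf x y)"

definition U :: "'a \<Rightarrow> 'a \<Rightarrow> 'a" where
  "U x y =
     (if 0 < f x then if 0 < f y then add_below x y else x
      else if 0 < f y then y
      else if x \<le> a \<and> y \<le> a then add_mid x y
      else if a < x \<and> a < y then op_above x y
      else a)"

lemma nonneg_sum_range:
  assumes "0 \<le> f x" "0 \<le> f y" "f x + f y \<le> f bot"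
  shows "f x + f y \<in> range f"
proof -
  have "f a \<le> f x + f y"
    using assms f_a_nonpos add_nonneg_nonneg order_trans by blast
  with cond_i[of x y] assms show ?thesis by (auto simp: max_def split: if_splits)
qed

lemma f_add_below:
  assumes "0 \<le> f x" "0 \<le> f y"
  shows "f (add_below x y) = min (f x + f y) (f bot)"
proof -
  have "min (f x + f y) (f bot) \<in> range f"
    using nonneg_sum_range[OF assms] by (auto simp: min_def)
  then show ?thesis by (simp add: add_below_def f_inv_into_f)
qed

text \<open>The truncated sum is at most 0, hence at most \<open>f bot\<close>, so condition (i)
  leaves only the range.\<close>

lemma f_add_mid:
  assumes "f x \<in> {f a..0}" "f y \<in> {f a..0}"
  shows "f (add_mid x y) = max (f x + f y) (f a)"
    and "max (f x + f y) (f a) \<in> range f"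
proof -
  have "max (f x + f y) (f a) \<le> 0"
    using assms f_a_nonpos by (auto intro: add_nonpos_nonpos)
  then have "\<not> f bot < max (f x + f y) (f a)"
    using f_bot_nonneg order_trans by (auto simp only: not_less)
  then show *: "max (f x + f y) (f a) \<in> range f"
    using cond_i[of x y] assms by simp
  then show "f (add_mid x y) = max (f x + f y) (f a)"
    by (simp add: add_mid_def f_inv_into_f)
qed

lemma mid_bounds: "x \<le> a \<Longrightarrow> \<not> 0 < f x \<Longrightarrow> f x \<in> {f a..0}"
  using antimonoD[OF decreasing_f, of x a] by auto

section \<open>Closure and associativity of the three partial operations\<close>

lemma add_below_pos: "0 < f x \<Longrightarrow> 0 < f y \<Longrightarrow> 0 < f (add_below x y)"
  using f_add_below[of x y] f_le_bot[of x] by (auto simp: add_pos_pos)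

lemma add_below_assoc:
  assumes "0 < f x" "0 < f y" "0 < f z"
  shows "add_below (add_below x y) z = add_below x (add_below y z)"
proof (rule f_eq_iff[THEN iffD1])
  have le: "f bot \<le> f bot + f w" if "0 < f w" for w
    using that by (simp add: add_increasing2)
  have "f (add_below (add_below x y) z) = min (min (f x + f y) (f bot) + f z) (f bot)"
    using assms add_below_pos[of x y] f_add_below[of x y] f_add_below[of "add_below x y" z]
    by (metis less_imp_le)
  moreover have "f (add_below x (add_below y z)) = min (min (f y + f z) (f bot) + f x) (f bot)"
    using assms add_below_pos[of y z] f_add_below[of y z] f_add_below[of x "add_below y z"]
    by (metis add.commute less_imp_le)
  ultimately show "f (add_below (add_below x y) z) = f (add_below x (add_below y z))"
    using assms by (simp only: min_add_min_absorb[OF le]) (simp add: ac_simps)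
qed

lemma add_mid_e1: "x \<le> a \<Longrightarrow> \<not> 0 < f x \<Longrightarrow> add_mid e1 x = x"
  using mid_bounds[of x] inj_f by (simp add: add_mid_def f_e1 max_absorb1)

lemma add_mid_commute: "add_mid x y = add_mid y x"
  by (simp add: add_mid_def add.commute)

text \<open>Values between \<open>f a\<close> and 0 may also belong to elements incomparable with
  \<open>a\<close>; condition (v) keeps sums away from these. It asks for strictly negative values,
  hence the separate case of \<open>e1\<close>.\<close>

lemma add_mid_closed:
  assumes "x \<le> a" "\<not> 0 < f x" "y \<le> a" "\<not> 0 < f y"
  shows "add_mid x y \<le> a" and "\<not> 0 < f (add_mid x y)"
proof -
  note bounds = mid_bounds[OF assms(1,2)] mid_bounds[OF assms(3,4)]
  show "\<not> 0 < f (add_mid x y)"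
    using f_add_mid(1)[OF bounds] bounds f_a_nonpos
    by (auto simp: not_less intro: add_nonpos_nonpos)
  show "add_mid x y \<le> a"
  proof (cases "x = e1 \<or> y = e1")
    case True
    then show ?thesis
      using assms add_mid_e1 add_mid_commute[of x] by auto
  next
    case False
    then have neg: "f x < 0" "f y < 0"
      using bounds f_e1 by (metis atLeastAtMost_iff f_eq_iff le_less)+
    show ?thesis
    proof (cases "f a < f x + f y")
      case True
      have "f x + f y < 0"
        using neg by (cases "f x"; cases "f y") auto
      \<comment> \<open>Adding a negative value cannot raise the sum, so each value is at least the
        sum.\<close>
      moreover have "f a < f x" "f a < f y"
        using True bounds neg add_left_mono[of "f y" 0 "f x"] add_right_mono[of "f x" 0 "f y"]
        by auto
      moreover have "f x + f y \<in> range f"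
        using f_add_mid(2)[OF bounds] True by (simp add: max_absorb1)
      ultimately have "comparable (add_mid x y) a"
        using cond_v[of x y] True neg by (simp add: add_mid_def max_absorb1)
      then show ?thesis
        using f_add_mid(1)[OF bounds] le_iff by simp
    next
      case False
      then show ?thesis
        using inj_f by (simp add: add_mid_def max_absorb2)
    qed
  qed
qed

lemma add_mid_assoc:
  assumes "x \<le> a" "\<not> 0 < f x" "y \<le> a" "\<not> 0 < f y" "z \<le> a" "\<not> 0 < f z"
  shows "add_mid (add_mid x y) z = add_mid x (add_mid y z)"
proof (rule f_eq_iff[THEN iffD1])
  have le: "f a + f w \<le> f a" if "\<not> 0 < f w" for w
    using that by (simp add: add_decreasing2)
  have f_mid: "f (add_mid v w) = max (f v + f w) (f a)"
    if "v \<le> a" "\<not> 0 < f v" "w \<le> a" "\<not> 0 < f w" for v w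
    using that f_add_mid(1) mid_bounds by blast
  have "f (add_mid (add_mid x y) z) = max (f x + f y + f z) (f a)"
    using assms add_mid_closed f_mid max_add_max_absorb[OF le] by simp
  moreover have "f (add_mid x (add_mid y z)) = max (f y + f z + f x) (f a)"
    using assms add_mid_closed f_mid max_add_max_absorb[OF le[of x], of "f y + f z"]
    by (simp add: add.commute[of "f x"])
  ultimately show "f (add_mid (add_mid x y) z) = f (add_mid x (add_mid y z))"
    by (simp add: ac_simps)
qed

lemma add_mid_a:
  assumes "x \<le> a" "\<not> 0 < f x"
  shows "add_mid a x = a" "add_mid x a = a"
proof -
  have "f a + f x \<le> f a"
    using assms by (simp add: add_decreasing2)
  then show "add_mid a x = a"
    using inj_f by (simp add: add_mid_def max_absorb2)
  then show "add_mid x a = a"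
    by (simp add: add_mid_commute)
qed

lemma op_above_cases:
  assumes "a < x" "a < y"
  obtains "x \<le> y" "op_above x y = (if e2 < y then y else x)"
    | "y \<le> x" "op_above x y = (if e2 < x then x else y)"
proof (cases "x \<le> y")
  case True
  then have "op_above x y = (if e2 < y then y else x)"
    using less_le_trans[of e2 x y] by (simp add: op_above_def sup_absorb2 inf_absorb1)
  with that(1) True show thesis .
next
  case False
  then have "y \<le> x"
    using above_a_comparable[of x y] assms by (auto simp: comparable_def)
  moreover from this have "op_above x y = (if e2 < x then x else y)"
    using less_le_trans[of e2 y x] by (simp add: op_above_def sup_absorb1 inf_absorb2)
  ultimately show thesis
    using that(2) by simp
qed

lemma op_above_closed: "a < x \<Longrightarrow> a < y \<Longrightarrow> a < op_above x y"
  by (rule op_above_cases[of x y]) auto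

text \<open>Both bracketings reduce to the join of all three elements if one of them exceeds
  \<open>e2\<close>, and to their meet otherwise.\<close>

lemma op_above_assoc:
  assumes "a < x" "a < y" "a < z"
  shows "op_above (op_above x y) z = op_above x (op_above y z)"
proof -
  have big: "e2 < op_above v w \<longleftrightarrow> e2 < v \<or> e2 < w" if "a < v" "a < w" for v w
    using that by (rule op_above_cases) (auto dest: less_le_trans)
  \<comment> \<open>On the chain, \<open>v\<close> and \<open>w\<close> lie below \<open>u\<close>,
    so the inner meet may be exchanged for a join.\<close>
  have absorb: "sup (inf v w) u = sup v (sup w u) \<and> sup u (inf v w) = sup u (sup v w)"
    if "e2 < u" "\<not> e2 < v" "\<not> e2 < w" "a < u" "a < v" "a < w" for u v w
  proof -
    have "v \<le> u" "w \<le> u"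
      using that above_a_comparable[OF less_imp_le less_imp_le, of u v]
        above_a_comparable[OF less_imp_le less_imp_le, of u w]
        less_le_trans[of e2 u v] less_le_trans[of e2 u w]
      by (auto simp: comparable_def)
    then show ?thesis
      by (simp add: sup_absorb1 sup_absorb2 le_infI1)
  qed
  have "op_above (op_above x y) z =
      (if e2 < x \<or> e2 < y \<or> e2 < z then sup x (sup y z) else inf x (inf y z))"
    using assms big[of x y] absorb[of z x y]
    by (auto simp: op_above_def[of _ z] op_above_def[of x] sup_assoc inf_assoc)
  moreover have "op_above x (op_above y z) =
      (if e2 < x \<or> e2 < y \<or> e2 < z then sup x (sup y z) else inf x (inf y z))"
    using assms big[of y z] absorb[of x y z]
    by (auto simp: op_above_def[of x] op_above_def[of y])
  ultimately show ?thesis by simp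
qed

lemma above_not_le:
  assumes "a < x"
  shows "\<not> x \<le> a \<and> \<not> 0 < f x"
  using pos_le_a[of x] less_le_not_le[of a x] assms by blast

section \<open>Associativity and commutativity of \<open>U\<close>\<close>

text \<open>Each case decides all position tests in \<open>U\<close>, so that simplification can
  evaluate it.\<close>

lemma position_cases:
  obtains (pos) "0 < f x" "\<not> a < x" "x \<le> a"
    | (mid) "\<not> 0 < f x" "\<not> a < x" "x \<le> a"
    | (above) "\<not> 0 < f x" "a < x" "\<not> x \<le> a"
    | (incomp) "\<not> 0 < f x" "\<not> a < x" "\<not> x \<le> a"
  using pos_le_a[of x] above_not_le[of x] by blast

lemma U_assoc: "U (U x y) z = U x (U y z)"
proof -
  have a: "\<not> 0 < f a"
    using f_a_nonpos by (simp add: not_less)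
  have mid: "\<not> a < add_mid v w" if "v \<le> a" "\<not> 0 < f v" "w \<le> a" "\<not> 0 < f w" for v w
    using add_mid_closed(1)[OF that] by auto
  note closed = add_below_pos add_mid_closed op_above_closed above_not_le[OF op_above_closed]
  note assoc = add_below_assoc add_mid_assoc op_above_assoc
  show ?thesis
    by (cases x rule: position_cases; cases y rule: position_cases; cases z rule: position_cases)
      (simp_all add: U_def a mid closed assoc add_mid_a)
qed

lemma U_commute: "U x y = U y x"
  by (auto simp: U_def add_below_def add_mid_commute op_above_def ac_simps)

section \<open>Common summands and monotonicity\<close>

text \<open>Provides the shared summand \<open>f z\<close> through which condition (ii) compares
  translates by \<open>z\<close>.\<close>

lemma summand_sum:
  assumes "f w = f x + f z" "f z \<noteq> 0" "f w \<noteq> 0" "0 \<le> f z * f x"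
  shows "summand_in (range f) (f z) (f w)"
  unfolding summand_in_def
proof (intro conjI bexI)
  show "f w = f z + f x"
    using assms by (simp add: add.commute)
  show "f w \<in> range f"
    by simp
qed (use assms in auto)

lemma summand_self: "f x \<noteq> 0 \<Longrightarrow> summand_in (range f) (f x) (f x)"
  unfolding summand_in_def
  using f_e1 by (auto intro!: exI[of _ e1])

text \<open>Without truncation, \<open>z\<close> and the sum share the summand \<open>f z\<close>,
  so (ii) compares them; a truncated sum gives \<open>bot\<close>.\<close>

lemma add_below_le:
  assumes "0 < f x" "0 < f z"
  shows "add_below x z \<le> z"
proof (cases "f x + f z \<le> f bot")
  case True
  then have eq: "f (add_below x z) = f x + f z"
    using f_add_below assms by simp
  have "summand_in (range f) (f z) (f (add_below x z))"
    using assms eq add_pos_pos[of "f x" "f z"] by (intro summand_sum[of _ x]) auto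
  moreover have "summand_in (range f) (f z) (f z)"
    using assms by (intro summand_self) simp
  ultimately have "comparable (add_below x z) z"
    using assms add_below_pos[of x z] by (intro cond_ii) auto
  then show ?thesis
    using eq assms le_iff by (simp add: add_increasing)
next
  case False
  then show ?thesis
    using inj_f by (simp add: add_below_def min_absorb2)
qed

lemma add_below_mono:
  assumes "0 < f y" "0 < f z" "x \<le> y"
  shows "add_below x z \<le> add_below y z"
proof (cases "f x + f z \<le> f bot")
  case True
  have "f y \<le> f x"
    using antimonoD[OF decreasing_f assms(3)] .
  then have x: "0 < f x" and le: "f y + f z \<le> f x + f z"
    using assms by (auto intro: add_right_mono)
  then have eq: "f (add_below x z) = f x + f z" "f (add_below y z) = f y + f z"
    using f_add_below True assms by auto
  have "summand_in (range f) (f z) (f (add_below x z))"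
    using assms x eq add_pos_pos[of "f x" "f z"] by (intro summand_sum[of _ x]) auto
  moreover have "summand_in (range f) (f z) (f (add_below y z))"
    using assms eq add_pos_pos[of "f y" "f z"] by (intro summand_sum[of _ y]) auto
  ultimately have "comparable (add_below x z) (add_below y z)"
    using assms x add_below_pos[of x z] add_below_pos[of y z] by (intro cond_ii) auto
  then show ?thesis
    using eq le le_iff by simp
next
  case False
  then show ?thesis
    using inj_f by (simp add: add_below_def min_absorb2)
qed

lemma neg_iff: "f x < 0 \<longleftrightarrow> \<not> 0 < f x \<and> x \<noteq> e1"
  using f_e1 by (metis f_eq_iff less_asym less_irrefl linorder_neqE)

lemma add_mid_summand:
  assumes "x \<le> a" "\<not> 0 < f x" "z \<le> a" "f z < 0" "f a < f x + f z"
  shows "f (add_mid x z) = f x + f z"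
    and "summand_in (range f) (f z) (f (add_mid x z))"
proof -
  have "f (add_mid x z) = max (f x + f z) (f a)"
    using assms by (intro f_add_mid mid_bounds) auto
  then show eq: "f (add_mid x z) = f x + f z"
    using assms by simp
  have "f x + f z < 0"
    using assms by (cases "f x"; cases "f z") auto
  moreover have "0 \<le> f z * f x"
    using assms by (cases "f x"; cases "f z") (auto simp: mult_nonpos_nonpos not_less)
  ultimately show "summand_in (range f) (f z) (f (add_mid x z))"
    using assms eq by (intro summand_sum[of _ x]) auto
qed

lemma add_mid_eq_a: "\<not> f a < f x + f z \<Longrightarrow> add_mid x z = a"
  using inj_f by (simp add: add_mid_def max_absorb2)

lemma add_mid_ge:
  assumes "x \<le> a" "\<not> 0 < f x" "z \<le> a" "f z < 0"
  shows "z \<le> add_mid x z"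
proof (cases "f a < f x + f z")
  case True
  note sum = add_mid_summand[OF assms True]
  have "summand_in (range f) (f z) (f z)"
    using assms by (intro summand_self) simp
  then have "comparable z (add_mid x z)"
    using sum assms mid_bounds[of z] mid_bounds[OF add_mid_closed, of x z]
    by (intro cond_ii) auto
  then show ?thesis
    using sum(1) assms le_iff by (simp add: add_decreasing)
next
  case False
  then show ?thesis
    using assms add_mid_eq_a by simp
qed

lemma add_mid_mono:
  assumes "\<not> 0 < f x" "x \<le> y" "y \<le> a" "z \<le> a" "\<not> 0 < f z"
  shows "add_mid x z \<le> add_mid y z"
proof -
  have le: "f y \<le> f x"
    using antimonoD[OF decreasing_f assms(2)] .
  then have x: "x \<le> a" and y: "\<not> 0 < f y"
    using assms by auto
  show ?thesis
  proof (cases "f a < f y + f z")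
    case True
    have sum_le: "f y + f z \<le> f x + f z"
      using le by (rule add_right_mono)
    show ?thesis
    \<comment> \<open>The value 0 of \<open>e1\<close> is never a summand, so (ii) does not apply;
      there \<open>e1\<close> acts as the identity.\<close>
    proof (cases "z = e1")
      case True
      then show ?thesis
        using assms x y add_mid_e1 add_mid_commute[of _ e1] by simp
    next
      case False
      then have z: "f z < 0"
        using assms neg_iff by simp
      note sums = add_mid_summand[OF x assms(1,4) z less_le_trans[OF True sum_le]]
        add_mid_summand[OF assms(3) y assms(4) z True]
      have "f (add_mid x z) \<in> {f a..0}" "f (add_mid y z) \<in> {f a..0}"
        using assms x y add_mid_closed by (auto intro!: mid_bounds simp del: atLeastAtMost_iff)
      then have "comparable (add_mid x z) (add_mid y z)"
        using sums by (intro cond_ii) auto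
      then show ?thesis
        using sums sum_le le_iff by simp
    qed
  next
    \<comment> \<open>The right side is truncated to \<open>a\<close>, which bounds all products in
      this block.\<close>
    case False
    then show ?thesis
      using assms x add_mid_closed add_mid_eq_a by simp
  qed
qed

lemma op_above_mono:
  assumes "a < x" "x \<le> y" "a < z"
  shows "op_above x z \<le> op_above y z"
proof (cases "e2 < x \<or> e2 < z")
  case True
  with assms show ?thesis
    by (auto simp: op_above_def le_supI1 dest: less_le_trans)
next
  \<comment> \<open>The left side is a meet, hence below the right side whether that is a join or a
    meet.\<close>
  case False
  with assms show ?thesis
    by (auto simp: op_above_def intro: inf_mono le_infI1 le_supI1)
qed

text \<open>Covers the passage from positive to nonpositive values, where \<open>U x z = x\<close>.
  For \<open>y = e1\<close> the product is \<open>z\<close>, and only condition (iii) compares it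
  with \<open>x\<close>.\<close>

lemma le_add_mid_pos:
  assumes "0 < f x" "x \<le> y" "y \<le> a" "\<not> 0 < f y" "z \<le> a" "\<not> 0 < f z"
  shows "x \<le> add_mid y z"
proof (cases "y = e1")
  case True
  have "x \<le> z"
  proof (cases "z = e1")
    case False
    then have "f z < 0"
      using assms neg_iff by simp
    moreover have "x < e1"
      using assms True f_e1 by (auto simp: less_le)
    ultimately have "comparable z x"
      using cond_iii[of z x] assms mid_bounds[of z] by auto
    then show ?thesis
      using le_iff[of x z] assms by (auto simp: comparable_def)
  qed (use True assms in simp)
  then show ?thesis
    using True assms add_mid_e1 by simp
next
  case False
  then have "y \<le> add_mid z y"
    using assms neg_iff by (intro add_mid_ge) auto
  then show ?thesis
    using assms add_mid_commute[of y] by auto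
qed

lemma U_mono_left:
  assumes "x \<le> y"
  shows "U x z \<le> U y z"
proof -
  \<comment> \<open>These implications discard the pairs of positions that are incompatible with
    \<open>x \<le> y\<close>.\<close>
  have "0 < f y \<Longrightarrow> 0 < f x" "a < x \<Longrightarrow> a < y" "y \<le> a \<Longrightarrow> x \<le> a"
    using antimonoD[OF decreasing_f assms] assms by auto
  moreover have "v \<le> op_above y z" if "v \<le> a" "a < y" "a < z" for v
    using op_above_closed[OF that(2,3)] that(1) by auto
  ultimately show ?thesis
    using assms
    by (cases x rule: position_cases; cases y rule: position_cases; cases z rule: position_cases)
      (simp_all add: U_def add_below_mono add_below_le le_add_mid_pos add_mid_mono add_mid_closed
        op_above_mono)
qed

section \<open>Neutral elements\<close>

lemma U_neutral_e1: "x \<le> a \<Longrightarrow> U e1 x = x"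
  using e1_le_a by (auto simp: U_def f_e1 add_mid_e1)

lemma U_neutral_e2:
  assumes "a \<le> x"
  shows "U e2 x = x"
proof (cases "a = e2")
  \<comment> \<open>Since \<open>a\<close> is now the top element, only \<open>x = a\<close>
    remains.\<close>
  case True
  then have "x = a"
    using boundary_e2 assms by (simp add: top_unique)
  moreover have "U a a = a"
    using f_a_nonpos by (auto simp: U_def add_mid_a)
  ultimately show ?thesis
    using True by simp
next
  case False
  then have e2: "a < e2"
    using a_le_e2 by simp
  show ?thesis
  proof (cases "x = a")
    case True
    with e2 above_not_le[OF e2] f_a_nonpos show ?thesis
      by (auto simp: U_def)
  next
    case False
    then have "a < x"
      using assms by simp
    then have "op_above e2 x = x"
      using above_a_comparable[of e2 x] a_le_e2
      by (auto simp: op_above_def comparable_def sup_absorb2 inf_absorb2 le_less)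
    then show ?thesis
      using e2 above_not_le[OF e2] above_not_le \<open>a < x\<close> by (simp add: U_def)
  qed
qed

lemma two_uninorm_U: "two_uninorm e1 a e2 U"
proof -
  have "U x y \<le> U x' y'" if "x \<le> x'" "y \<le> y'" for x x' y y'
    using U_mono_left[OF that(1), of y] U_mono_left[OF that(2), of x'] U_commute[of x']
    by auto
  then show ?thesis
    using e1_le_a a_le_e2 U_commute U_assoc U_neutral_e1 U_neutral_e2
    by (auto simp: two_uninorm_def)
qed

section \<open>Agreement of \<open>U\<close> with \<open>U_d\<close>\<close>

lemma pseudo_inverse_f: "pseudo_inverse f (f x) = Some x"
  using inj_f by (simp add: pseudo_inverse_range)

lemma pseudo_inverse_nonneg_sum:
  assumes "0 \<le> f x" "0 \<le> f y"
  shows "pseudo_inverse f (f x + f y) = Some (add_below x y)"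
proof (cases "f x + f y \<le> f bot")
  case True
  then show ?thesis
    using nonneg_sum_range[OF assms] by (simp add: pseudo_inverse_range add_below_def min_absorb1)
next
  case False
  then show ?thesis
    using pseudo_inverse_above[OF decreasing_f] inj_f
    by (simp add: add_below_def min_absorb2)
qed

lemma pseudo_inverse_max:
  "pseudo_inverse f (max (f x) (f y)) = Some (if f x \<le> f y then y else x)"
  by (simp add: pseudo_inverse_f max_def)

lemma pseudo_inverse_min:
  "pseudo_inverse f (min (f x) (f y)) = Some (if f x \<le> f y then x else y)"
  by (simp add: pseudo_inverse_f min_def)

text \<open>Reconciles the closed condition \<open>0 \<le> f x\<close> of \<open>U_d\<close> with
  the strict one of \<open>U\<close>: only \<open>e1\<close> has value 0, and it is neutral for both
  sums.\<close>

lemma add_below_nonneg_eq_U: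
  assumes "0 \<le> f x" "0 \<le> f y"
  shows "add_below x y = U x y"
proof -
  have zero: "w = e1" if "0 \<le> f w" "\<not> 0 < f w" for w
    using that neg_iff[of w] by auto
  show ?thesis
    using assms zero[of x] zero[of y] inj_f f_le_bot e1_le_a add_mid_e1[of e1]
    by (auto simp: U_def add_below_def f_e1 min_absorb1)
qed

lemma below_e2_iff: "f x < f e2 \<longleftrightarrow> e2 < x"
  using f_less_e2_iff[of x] f_less_a_iff[of x] f_strict[of e2 x]
    antimonoD[OF decreasing_f a_le_e2] by (auto simp: less_imp_le)

lemma mid_iff: "f x \<in> {f a..0} \<longleftrightarrow> \<not> 0 < f x \<and> \<not> a < x"
  using f_less_a_iff[of x] by (auto simp: not_less[symmetric])

lemma op_above_value:
  assumes "a < x" "a < y"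
  shows "op_above x y =
    (if e2 < x \<or> e2 < y then if f x \<le> f y then x else y else if f x \<le> f y then y else x)"
  using le_iff[OF above_a_comparable, of x y] le_iff[OF above_a_comparable, of y x]
    above_a_comparable[of x y] assms
  by (auto simp: op_above_def comparable_def sup_absorb1 sup_absorb2 inf_absorb1 inf_absorb2
      less_imp_le)

text \<open>Every pseudo-inverse is taken either on the range or beyond \<open>f bot\<close>, so it
  exists although the lattice need not be complete.\<close>

lemma U_d_eq_U: "U_d f a e2 x y = Some (U x y)"
proof (cases "0 \<le> f x \<and> 0 \<le> f y")
  case True
  then show ?thesis
    by (simp add: U_d_def pseudo_inverse_nonneg_sum add_below_nonneg_eq_U)
next
  case False
  then have neg: "(0 \<le> f x \<and> 0 \<le> f y) = False" "0 < f x \<Longrightarrow> \<not> 0 < f y"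
    by auto
  have in_above: "f w \<in> {-\<infinity>..<f a} \<longleftrightarrow> a < w"
    and in_above_e2: "f w \<in> {-\<infinity>..<f e2} \<longleftrightarrow> e2 < w"
    and in_upto_e2: "f w \<in> {f e2..<f a} \<longleftrightarrow> a < w \<and> \<not> e2 < w"
    and in_nonneg: "f w \<in> {0..\<infinity>} \<longleftrightarrow> 0 \<le> f w" for w
    by (auto simp: f_less_a_iff below_e2_iff not_less[symmetric])
  have mid: "pseudo_inverse f (max (f x + f y) (f a)) = Some (add_mid x y)"
    if "\<not> 0 < f x" "\<not> a < x" "\<not> 0 < f y" "\<not> a < y"
    using f_add_mid(2)[of x y] that
    by (simp add: mid_iff pseudo_inverse_range add_mid_def del: atLeastAtMost_iff)
  have above: "\<not> e2 < w" if "\<not> a < w" for w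
    using a_le_e2 that by auto
  \<comment> \<open>When exactly one value is positive, the maximum in the last clause selects
    it.\<close>
  have le: "f x \<le> f y \<longleftrightarrow> \<not> 0 < f x" if "\<not> 0 < f x \<longleftrightarrow> 0 < f y"
    using that by auto
  show ?thesis
    using neg(2)
    unfolding U_d_def U_def mem_Sigma_iff Un_iff in_above in_above_e2 in_upto_e2 in_nonneg
      neg(1) if_False mid_iff G_set_iff incomparables_a pseudo_inverse_max pseudo_inverse_min
    by (cases x rule: position_cases; cases y rule: position_cases)
      (simp_all add: above mid le op_above_value)
qed

end

theorem theorem3p2:
  fixes f :: "'a::bounded_lattice \<Rightarrow> ereal" and e1 a e2 :: 'a
  assumes e1_le_a: "e1 \<le> a" and a_le_e2: "a \<le> e2"
    and inj_f: "inj f"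
    and decreasing_f: "antimono f"
    and f_e1: "f e1 = 0"
    and cond_i: "\<And>x y. (f x, f y) \<in> {f a..0} \<times> {f a..0} \<union> {0..\<infinity>} \<times> {0..\<infinity>} \<Longrightarrow>
          max (f x + f y) (f a) \<in> range f \<union> {f bot<..\<infinity>}"
    and cond_ii: "\<And>x y. (f x, f y) \<in> {f a..0} \<times> {f a..0} \<union> {0..\<infinity>} \<times> {0..\<infinity>} \<Longrightarrow>
          (\<exists>z. summand_in (range f) (f z) (f x) \<and> summand_in (range f) (f z) (f y)) \<Longrightarrow>
          comparable x y"
    and cond_iii: "\<And>x y. f a \<le> f x \<Longrightarrow> f x < 0 \<Longrightarrow> 0 < f y \<Longrightarrow> y < e1 \<Longrightarrow> comparable x y"
    and cond_iv: "\<And>x y. (f a \<ge> f x \<and> f x > f y) \<or> (f x \<le> f a \<and> f a < 0 \<and> 0 < f y) \<Longrightarrow>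
          comparable x y"
    and cond_v: "\<And>x y. f x \<in> {f a<..<0} \<Longrightarrow> f y \<in> {f a<..<0} \<Longrightarrow>
          f x + f y \<in> range f \<Longrightarrow> f a \<le> f x + f y \<Longrightarrow> f x + f y < 0 \<Longrightarrow>
          comparable (inv f (f x + f y)) a"
    (* The last two assumptions are vacuous for e1 < a < e2.  In the boundary cases e1 = a and
       a = e2 each of them is necessary for the conclusion. *)
    and boundary_e1: "\<And>x y. e1 = a \<Longrightarrow> f x \<le> f a \<Longrightarrow> 0 < f y \<Longrightarrow> comparable x y"
    and boundary_e2: "a = e2 \<Longrightarrow> a = top"
  shows "\<exists>U. (\<forall>x y. U_d f a e2 x y = Some (U x y)) \<and> two_uninorm e1 a e2 U"
proof -
  interpret generator_2_uninorm f e1 a e2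
    by unfold_locales (fact assms)+
  show ?thesis
    using U_d_eq_U two_uninorm_U by blast
qed

end
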